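(* Suppose $\gamma_n<0$ for all $n$, $E\varepsilon_0^2=1$, $E|\varepsilon_0|^{4+\delta}<\infty$ for some $\delta>0$, and, as $n\to\infty$, $$n\alpha_n\to\infty,\quad n^{1/2}\gamma_n\to0,\quad n|\gamma_n|\to\infty,\quad \alpha_n n^{1/2}\log\log n\to0,\quad \frac{|\gamma_n|^{3/2}}{\alpha_n}\to0.$$ Let $N\ge1$ be a fixed integer and $0<t_1<t_2<\cdots<t_N\le1$. Then the random variables $$\Big(\frac{|\gamma|}{\omega}\Big)^{1/2}y_{[nt_m]},\qquad 1\le m\le N,$$ are asymptotically independent, each with asymptotic distribution equal to the distribution of $\varepsilon_0$; that is, as $n\to\infty$ they converge jointly in distribution to a vector of $N$ independent copies of $\varepsilon_0$.
   Context: Let $\varepsilon_0,\varepsilon_1,\varepsilon_2,\dots$ be independent identically distributed real random variables (not necessarily of mean zero) such that the distribution of $\varepsilon_0^2$ is nondegenerate. Let $\omega>0$ be a constant. For each $n\ge1$ let $\alpha=\alpha_n\ge0$ and $\beta=\beta_n\ge0$ be real numbers with $\alpha_n\to0$ and $\beta_n\to1$ as $n\to\infty$. Given an initial value $\sigma_0$ (a fixed real number not depending on $n$) and $y_0=\sigma_0\varepsilon_0$, define for each $n$ the sequences $\sigma_k\ge 0$ and $y_k$, $1\le k\le n$ (which depend on $n$ through $\alpha_n,\beta_n$), by $y_k=\sigma_k\varepsilon_k$ and $\sigma_k^2=\omega+\alpha y_{k-1}^2+\beta\sigma_{k-1}^2$. Put $\gamma=\gamma_n=\alpha_n+\beta_n-1$.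 $[x]$ denotes the integer part of $x$. *)

theory Defs
  imports "HOL-Probability.Probability"
begin

text \<open>
  The GARCH(1,1) volatility along one path \<open>e\<close> of the innovations. The nonnegative root is taken
  for \<open>k \<ge> 1\<close>, while the initial value \<open>s\<close> may be any real number.
\<close>
primrec garch_vol :: "real \<Rightarrow> real \<Rightarrow> real \<Rightarrow> real \<Rightarrow> (nat \<Rightarrow> real) \<Rightarrow> nat \<Rightarrow> real" where
  "garch_vol w a b s e 0 = s"
| "garch_vol w a b s e (Suc k) =
     sqrt (w + a * (garch_vol w a b s e k * e k)\<^sup>2 + b * (garch_vol w a b s e k)\<^sup>2)"

definition garch :: "real \<Rightarrow> real \<Rightarrow> real \<Rightarrow> real \<Rightarrow> (nat \<Rightarrow> real) \<Rightarrow> nat \<Rightarrow> real" where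
  "garch w a b s e k = garch_vol w a b s e k * e k"

text \<open>
  Weak convergence against bounded continuous test functions. The library's \<^const>\<open>weak_conv_m\<close>
  covers only measures on the real line.
  The definition is meant for Borel measures on the topological space \<open>X\<close>. In particular, for finite
  \<open>I\<close> it applies to \<open>PiM I (\<lambda>_. borel)\<close>, whose measurable sets are the Borel sets of the
  product topology on the extensional functions on \<open>I\<close>.
\<close>
definition weak_conv_on :: "'a topology \<Rightarrow> (nat \<Rightarrow> 'a measure) \<Rightarrow> 'a measure \<Rightarrow> bool" where
  "weak_conv_on X \<mu> \<nu> \<longleftrightarrow>
     (\<forall>f. continuous_map X euclideanreal f \<and> bounded (f ` topspace X) \<longrightarrow>
          (\<lambda>n. integral\<^sup>L (\<mu> n) f) \<longlonglongrightarrow> integral\<^sup>L \<nu> f)"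

end

theory Submission
  imports Defs
begin

text \<open>
  Put \<open>m = \<omega> / \<bar>\<gamma>\<bar>\<close>, the fixed point of \<open>m = \<omega> + (\<alpha> + \<beta>) m\<close>. The deviation \<open>X\<^sub>k = \<sigma>\<^sub>k\<^sup>2 - m\<close> satisfies
  \<open>X\<^sub>k\<^sub>+\<^sub>1 = (1 + \<gamma>) X\<^sub>k + \<alpha> (\<epsilon>\<^sub>k\<^sup>2 - 1) \<sigma>\<^sub>k\<^sup>2\<close>, whose last summand is orthogonal to the first.
  Hence the mean square of \<open>X\<^sub>k / m\<close> is at most a constant times \<open>exp (- k \<bar>\<gamma>\<bar> / 2) + \<alpha>\<^sup>2 / \<bar>\<gamma>\<bar>\<close>, and
  \<open>\<alpha>\<^sup>2 / \<bar>\<gamma>\<bar> = (\<alpha> n\<^sup>1\<^sup>/\<^sup>2)\<^sup>2 / (n \<bar>\<gamma>\<bar>)\<close> tends to 0. So the normalised volatilities tend to 1 in probability,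
  while the innovations at the distinct times \<open>[n t\<^sub>m]\<close> are independent with a fixed law; a
  multiplicative Slutsky argument combines the two.
\<close>

section \<open>Continuous functions on countable products: measurability and uniform continuity on
  cubes\<close>

text \<open>The product metric is bounded by twice the largest distance among the first coordinates
  plus a tail \<open>(1/2)^k\<close>. A bound common to all coordinates survives as \<open>k\<close>
  grows, while the tail disappears.\<close>

lemma dist_fun_le:
  fixes x y :: "'i::countable \<Rightarrow> 'b::metric_space"
  assumes "\<And>i. dist (x i) (y i) \<le> d"
  shows "dist x y \<le> 2 * d"
proof (rule LIMSEQ_le_const)
  show "(\<lambda>k. 2 * d + (1/2)^k) \<longlonglongrightarrow> 2 * d"
    by (auto intro!: tendsto_eq_intros LIMSEQ_power_zero)
  have "dist x y \<le> 2 * d + (1/2)^k" for k :: nat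
  proof -
    have "Max {dist (x (from_nat n)) (y (from_nat n)) |n. n \<le> k} \<le> d"
      using assms by (subst Max_le_iff) auto
    then show ?thesis
      using dist_fun_le_dist_first_terms[of x y k] by linarith
  qed
  then show "\<exists>N. \<forall>k\<ge>N. dist x y \<le> 2 * d + (1/2)^k" by blast
qed

text \<open>Carries \<open>f\<close> from the extensional functions on \<open>I\<close> to the full
  function type, where the type-class topology and metric are available. Restriction is continuous
  because each of its coordinates is a projection.\<close>

lemma continuous_on_restrict_product:
  fixes f :: "('i \<Rightarrow> 'b::topological_space) \<Rightarrow> 'c::topological_space"
  assumes "continuous_map (product_topology (\<lambda>_. euclidean) I) euclidean f"
  shows "continuous_on UNIV (\<lambda>x. f (restrict x I))"
proof -
  have "continuous_map (product_topology (\<lambda>_. euclidean) UNIV) (product_topology (\<lambda>_. euclidean) I)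
          (\<lambda>x :: 'i \<Rightarrow> 'b. restrict x I)"
    by (subst continuous_map_componentwise)
       (auto intro: continuous_map_product_projection)
  then have "continuous_map (product_topology (\<lambda>_. euclidean) UNIV) euclidean (\<lambda>x. f (restrict x I))"
    using assms by (rule continuous_map_compose[unfolded o_def])
  then show ?thesis
    by (simp add: euclidean_product_topology)
qed

text \<open>Over a countable index type and a second countable space the product sigma-algebra is
  the Borel one, so the extension of \<open>f\<close> to all functions is measurable. Composing it
  with the inclusion of \<open>PiM I\<close> into \<open>PiM UNIV\<close> gives back
  \<open>f\<close>.\<close>

lemma borel_measurable_PiM_continuous_map:
  fixes f :: "('i::countable \<Rightarrow> 'b::second_countable_topology) \<Rightarrow> 'c::topological_space"
  assumes "continuous_map (product_topology (\<lambda>_. euclidean) I) euclidean f"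
  shows "f \<in> borel_measurable (PiM I (\<lambda>_. borel))"
proof -
  have "(\<lambda>x. f (restrict x I)) \<in> borel_measurable borel"
    by (intro borel_measurable_continuous_onI continuous_on_restrict_product assms)
  then have g: "(\<lambda>x. f (restrict x I)) \<in> measurable (PiM UNIV (\<lambda>_. borel)) borel"
    using sets_PiM_equal_borel[where 'a='i and 'b='b] measurable_cong_sets by blast
  have "(\<lambda>x i. x i) \<in> measurable (PiM I (\<lambda>_. borel :: 'b measure)) (PiM UNIV (\<lambda>_. borel))"
  proof (rule measurable_PiM_single')
    fix i :: 'i
    show "(\<lambda>x. x i) \<in> measurable (PiM I (\<lambda>_. borel :: 'b measure)) borel"
    \<comment> \<open>Points of \<open>PiM I\<close> take the constant value
      \<open>undefined\<close> outside \<open>I\<close>, so those coordinates are measurable as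
      well.\<close>
    proof (cases "i \<in> I")
      case False
      have "(\<lambda>x. undefined) \<in> measurable (PiM I (\<lambda>_. borel :: 'b measure)) (borel :: 'b measure)"
        by simp
      then show ?thesis
        using False by (subst measurable_cong[where g="\<lambda>x. undefined"])
                       (auto simp: space_PiM PiE_def extensional_def)
    qed (rule measurable_component_singleton)
  qed auto
  then have "(\<lambda>x. f (restrict (\<lambda>i. x i) I)) \<in> borel_measurable (PiM I (\<lambda>_. borel))"
    using g by (rule measurable_compose)
  then show ?thesis
    by (subst measurable_cong[where g="\<lambda>x. f (restrict x I)"])
       (auto simp: space_PiM PiE_def extensional_restrict)
qed

text \<open>The cube is compact by Tychonoff, so \<open>f\<close> is uniformly continuous on it. On
  a bounded set, multiplying coordinates by factors near 1 is a small additive perturbation.\<close>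

lemma continuous_map_uniform_on_cube:
  fixes f :: "('i::countable \<Rightarrow> real) \<Rightarrow> real"
  assumes f: "continuous_map (product_topology (\<lambda>_. euclideanreal) I) euclideanreal f"
    and e: "e > 0" and R: "R > 0"
  shows "\<exists>d>0. \<forall>x s. (\<forall>i\<in>I. \<bar>x i\<bar> \<le> R \<and> \<bar>s i - 1\<bar> \<le> d) \<longrightarrow>
            \<bar>f (\<lambda>i\<in>I. s i * x i) - f (\<lambda>i\<in>I. x i)\<bar> < e"
proof -
  \<comment> \<open>The side is doubled so that the perturbed point, with factors of modulus at most
    2, also stays in the cube.\<close>
  define K :: "('i \<Rightarrow> real) set" where "K = PiE UNIV (\<lambda>_. {-2*R..2*R})"
  define g where "g x = f (restrict x I)" for x
  have "compactin (product_topology (\<lambda>_. euclideanreal) UNIV) K"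
    unfolding K_def by (subst compactin_PiE) auto
  then have "compact K"
    by (simp add: euclidean_product_topology)
  moreover have "continuous_on K g"
    using continuous_on_restrict_product[OF f] unfolding g_def
    by (rule continuous_on_subset) auto
  ultimately have "uniformly_continuous_on K g"
    by (rule compact_uniformly_continuous[rotated])
  then obtain d0 where d0: "d0 > 0"
    "\<And>x y. x \<in> K \<Longrightarrow> y \<in> K \<Longrightarrow> dist y x < d0 \<Longrightarrow> dist (g y) (g x) < e"
    using e unfolding uniformly_continuous_on_def by blast
  \<comment> \<open>\<open>d \<le> 1\<close> keeps the factors at most 2 in modulus;
    \<open>d * R \<le> d0 / 4\<close> turns into a distance of at most \<open>d0 / 2\<close> through
    \<open>dist_fun_le\<close>.\<close>
  define d where "d = min 1 (d0 / (4 * R))"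
  have d: "d > 0" "d \<le> 1" "d * R \<le> d0 / 4"
    using d0 R by (auto simp: d_def min_def field_simps)
  show ?thesis
  proof (intro exI[of _ d] conjI allI impI)
    fix x s :: "'i \<Rightarrow> real"
    assume A: "\<forall>i\<in>I. \<bar>x i\<bar> \<le> R \<and> \<bar>s i - 1\<bar> \<le> d"
    \<comment> \<open>The value 0 outside \<open>I\<close> puts both points in \<open>K\<close> and
      confines their difference to the coordinates in \<open>I\<close>; restriction to
      \<open>I\<close> undoes this extension.\<close>
    define x' where "x' i = (if i \<in> I then x i else 0)" for i
    define y' where "y' i = (if i \<in> I then s i * x i else 0)" for i
    have xK: "x' \<in> K"
      using A R by (force simp: K_def x'_def abs_le_iff)
    have close: "dist (y' i) (x' i) \<le> d0 / 4" for i
    proof (cases "i \<in> I")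
      case True
      have "dist (y' i) (x' i) = \<bar>s i - 1\<bar> * \<bar>x i\<bar>"
        using True by (simp add: x'_def y'_def dist_real_def abs_mult[symmetric] algebra_simps)
      also have "\<dots> \<le> d * R"
        using A True d by (intro mult_mono) auto
      finally show ?thesis using d by simp
    qed (use d0 in \<open>simp add: x'_def y'_def\<close>)
    have "\<bar>y' i\<bar> \<le> 2 * R" for i
    proof (cases "i \<in> I")
      case True
      have "\<bar>s i\<bar> \<le> 2" "\<bar>x i\<bar> \<le> R" using A True d by fastforce+
      then have "\<bar>s i\<bar> * \<bar>x i\<bar> \<le> 2 * R" by (intro mult_mono) auto
      then show ?thesis using True by (simp add: y'_def abs_mult)
    qed (use R in \<open>simp add: y'_def\<close>)
    then have yK: "y' \<in> K"
      by (auto simp: K_def abs_le_iff PiE_iff) (smt (verit))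
    have "dist y' x' < d0"
      using dist_fun_le[of y' x', OF close] d0 by simp
    then have "dist (g y') (g x') < e"
      using d0 xK yK by blast
    moreover have "restrict x' I = (\<lambda>i\<in>I. x i)" "restrict y' I = (\<lambda>i\<in>I. s i * x i)"
      by (auto simp: x'_def y'_def)
    ultimately show "\<bar>f (\<lambda>i\<in>I. s i * x i) - f (\<lambda>i\<in>I. x i)\<bar> < e"
      by (simp add: g_def dist_real_def)
  qed (use d in auto)
qed

section \<open>A multiplicative Slutsky argument in finitely many coordinates\<close>

text \<open>Outside a bad event, where some \<open>E n i\<close> is large or some
  \<open>S n i\<close> is far from 1, uniform continuity on a cube controls the difference of the
  integrands; on the bad event boundedness of \<open>f\<close> does. Only tightness of
  \<open>E\<close> enters, since its law is compared with itself.\<close>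

lemma (in prob_space) slutsky_mult:
  fixes E S :: "nat \<Rightarrow> 'i::countable \<Rightarrow> 'a \<Rightarrow> real"
  assumes I: "finite I"
    and E[measurable]: "\<And>n i. i \<in> I \<Longrightarrow> E n i \<in> borel_measurable M"
    and S[measurable]: "\<And>n i. i \<in> I \<Longrightarrow> S n i \<in> borel_measurable M"
    and tight: "\<And>i e. i \<in> I \<Longrightarrow> e > 0 \<Longrightarrow> \<exists>R. \<forall>n. prob {x\<in>space M. R < \<bar>E n i x\<bar>} < e"
    and conv: "\<And>i d. i \<in> I \<Longrightarrow> d > 0 \<Longrightarrow>
                 (\<lambda>n. prob {x\<in>space M. d < \<bar>S n i x - 1\<bar>}) \<longlonglongrightarrow> 0"
    and f: "continuous_map (product_topology (\<lambda>_. euclideanreal) I) euclideanreal f"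
    and bdd: "bounded (f ` topspace (product_topology (\<lambda>_. euclideanreal) I))"
  shows "(\<lambda>n. (\<integral>x. f (\<lambda>i\<in>I. S n i x * E n i x) \<partial>M) - (\<integral>x. f (\<lambda>i\<in>I. E n i x) \<partial>M)) \<longlonglongrightarrow> 0"
proof (rule LIMSEQ_I)
  fix e :: real assume e: "e > 0"
  obtain B0 where "\<And>y. y \<in> topspace (product_topology (\<lambda>_. euclideanreal) I) \<Longrightarrow> \<bar>f y\<bar> \<le> B0"
    using bdd by (auto simp: bounded_iff)
  then have B0: "\<bar>f (restrict y I)\<bar> \<le> B0" for y
    by (auto simp: PiE_iff)
  define B where "B = max 1 B0"
  have B: "B > 0" "\<And>y. \<bar>f (restrict y I)\<bar> \<le> B"
    using B0 by (auto simp: B_def le_max_iff_disj)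
  define c where "c = real (card I) + 1"
  have c: "c > 0" by (simp add: c_def add_nonneg_pos)
  \<comment> \<open>The bad event is a union of \<open>2 * card I\<close> events, each of
    probability at most \<open>e'\<close>, hence of probability at most \<open>e / (3 * B)\<close>.
    It contributes at most \<open>2 * e / 3\<close>, which together with the \<open>e / 4\<close>
    from its complement stays below \<open>e\<close>.\<close>
  define e' where "e' = e / (6 * B * c)"
  have e': "e' > 0" using e B c by (simp add: e'_def)
  have "\<forall>i\<in>I. \<exists>R. \<forall>n. prob {x\<in>space M. R < \<bar>E n i x\<bar>} < e'"
    using tight e' by blast
  then obtain R0 where R0: "\<And>i n. i \<in> I \<Longrightarrow> prob {x\<in>space M. R0 i < \<bar>E n i x\<bar>} < e'"
    by metis
  define R where "R = Max (insert 1 (R0 ` I))"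
  have R: "R > 0" "\<And>i. i \<in> I \<Longrightarrow> R0 i \<le> R"
    using I by (auto simp: R_def Max_ge_iff Max_gr_iff)
  have tail: "prob {x\<in>space M. R < \<bar>E n i x\<bar>} \<le> e'" if "i \<in> I" for i n
  proof -
    have "prob {x\<in>space M. R < \<bar>E n i x\<bar>} \<le> prob {x\<in>space M. R0 i < \<bar>E n i x\<bar>}"
      using R(2)[OF that] that by (intro finite_measure_mono) auto
    then show ?thesis using R0[OF that, of n] by simp
  qed
  obtain d where d: "d > 0"
    "\<And>x s. (\<And>i. i \<in> I \<Longrightarrow> \<bar>x i\<bar> \<le> R \<and> \<bar>s i - 1\<bar> \<le> d) \<Longrightarrow>
            \<bar>f (\<lambda>i\<in>I. s i * x i) - f (\<lambda>i\<in>I. x i)\<bar> < e / 4"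
    using continuous_map_uniform_on_cube[OF f, of "e/4" R] e R by auto
  have "\<forall>\<^sub>F n in sequentially. \<forall>i\<in>I. prob {x\<in>space M. d < \<bar>S n i x - 1\<bar>} < e'"
    using I e' by (subst eventually_ball_finite_distrib) (auto intro!: order_tendstoD(2)[OF conv] d(1))
  then obtain n0 where n0: "\<And>n i. n \<ge> n0 \<Longrightarrow> i \<in> I \<Longrightarrow> prob {x\<in>space M. d < \<bar>S n i x - 1\<bar>} < e'"
    by (auto simp: eventually_sequentially)
  note [measurable] = borel_measurable_PiM_continuous_map[OF f]
  show "\<exists>n0. \<forall>n\<ge>n0. norm ((\<integral>x. f (\<lambda>i\<in>I. S n i x * E n i x) \<partial>M) -
                         (\<integral>x. f (\<lambda>i\<in>I. E n i x) \<partial>M) - 0) < e"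
  proof (intro exI[of _ n0] allI impI)
    fix n assume n: "n \<ge> n0"
    define bad where "bad = (\<Union>i\<in>I. {x\<in>space M. R < \<bar>E n i x\<bar>}) \<union>
                            (\<Union>i\<in>I. {x\<in>space M. d < \<bar>S n i x - 1\<bar>})"
    have badM[measurable]: "bad \<in> sets M"
      unfolding bad_def using I by (intro sets.Un sets.finite_UN) measurable
    have "prob bad \<le> prob (\<Union>i\<in>I. {x\<in>space M. R < \<bar>E n i x\<bar>}) +
                     prob (\<Union>i\<in>I. {x\<in>space M. d < \<bar>S n i x - 1\<bar>})"
      unfolding bad_def using I by (intro measure_Un_le sets.finite_UN) measurable
    also have "\<dots> \<le> (\<Sum>i\<in>I. prob {x\<in>space M. R < \<bar>E n i x\<bar>}) +
                     (\<Sum>i\<in>I. prob {x\<in>space M. d < \<bar>S n i x - 1\<bar>})"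
      using I by (intro add_mono finite_measure_subadditive_finite) auto
    also have "\<dots> \<le> (\<Sum>i\<in>I. e') + (\<Sum>i\<in>I. e')"
      using tail n0[OF n] by (intro add_mono sum_mono) (auto intro: less_imp_le)
    also have "\<dots> \<le> 2 * c * e'"
      using e' by (simp add: c_def algebra_simps)
    also have "\<dots> = e / (3 * B)"
      using B c by (simp add: e'_def field_simps)
    finally have pbad: "prob bad \<le> e / (3 * B)" .
    let ?F = "\<lambda>x. f (\<lambda>i\<in>I. S n i x * E n i x)" and ?G = "\<lambda>x. f (\<lambda>i\<in>I. E n i x)"
    have F: "integrable M ?F" and G: "integrable M ?G"
      using B by (auto intro!: integrable_const_bound[where B=B])
    have ind: "integrable M (\<lambda>x. e / 4 + 2 * B * indicator bad x :: real)"
      by (intro Bochner_Integration.integrable_add integrable_mult_right) (auto simp: less_top[symmetric])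
    have "\<bar>(\<integral>x. ?F x \<partial>M) - (\<integral>x. ?G x \<partial>M)\<bar> = \<bar>\<integral>x. ?F x - ?G x \<partial>M\<bar>"
      using F G by simp
    also have "\<dots> \<le> (\<integral>x. \<bar>?F x - ?G x\<bar> \<partial>M)"
      by (rule integral_abs_bound)
    also have "\<dots> \<le> (\<integral>x. e / 4 + 2 * B * indicator bad x \<partial>M)"
    proof (intro integral_mono ind integrable_abs Bochner_Integration.integrable_diff F G)
      fix x assume x: "x \<in> space M"
      show "\<bar>?F x - ?G x\<bar> \<le> e / 4 + 2 * B * indicator bad x"
      proof (cases "x \<in> bad")
        case True
        then show ?thesis
          using B(2)[of "\<lambda>i. S n i x * E n i x"] B(2)[of "\<lambda>i. E n i x"] e by simp
      next
        case False
        then have "\<bar>E n i x\<bar> \<le> R \<and> \<bar>S n i x - 1\<bar> \<le> d" if "i \<in> I" for i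
          using x that by (auto simp: bad_def not_less)
        then show ?thesis
          using d(2)[of "\<lambda>i. E n i x" "\<lambda>i. S n i x"] False by simp
      qed
    qed
    also have "\<dots> = e / 4 + 2 * B * prob bad"
      by (subst Bochner_Integration.integral_add) (auto simp: prob_space less_top[symmetric])
    also have "\<dots> \<le> e / 4 + 2 * B * (e / (3 * B))"
      using pbad B by (intro add_left_mono mult_left_mono) auto
    also have "\<dots> < e"
      using B e by (simp add: field_simps)
    finally show "norm ((\<integral>x. ?F x \<partial>M) - (\<integral>x. ?G x \<partial>M) - 0) < e" by simp
  qed
qed

section \<open>The volatility recursion and its dependence on past innovations\<close>

lemma garch_vol_cong:
  assumes "\<And>j. j < k \<Longrightarrow> e j = e' j"
  shows "garch_vol w a b s e k = garch_vol w a b s e' k"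
  using assms by (induction k) auto

lemma garch_vol_nonneg:
  assumes "w \<ge> 0" "a \<ge> 0" "b \<ge> 0" "k > 0"
  shows "garch_vol w a b s e k \<ge> 0"
  using assms by (cases k) auto

lemma garch_vol_Suc_sq:
  assumes "w \<ge> 0" "a \<ge> 0" "b \<ge> 0"
  shows "(garch_vol w a b s e (Suc k))\<^sup>2 = w + (a * (e k)\<^sup>2 + b) * (garch_vol w a b s e k)\<^sup>2"
  using assms by (simp add: power_mult_distrib algebra_simps)

lemma measurable_garch_vol:
  assumes "\<And>j. j < k \<Longrightarrow> X j \<in> borel_measurable M"
  shows "(\<lambda>x. garch_vol w a b s (\<lambda>j. X j x) k) \<in> borel_measurable M"
  using assms
proof (induction k)
  case (Suc k)
  have [measurable]: "(\<lambda>x. garch_vol w a b s (\<lambda>j. X j x) k) \<in> borel_measurable M"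
    "X k \<in> borel_measurable M"
    using Suc by auto
  show ?case by simp
qed simp

text \<open>The volatility at time \<open>k\<close> is a function of the innovations at times below
  \<open>k\<close>, and the families of innovations over the disjoint index sets
  \<open>{..<k}\<close> and \<open>{k}\<close> are independent.\<close>

lemma (in prob_space) indep_var_garch_vol:
  assumes "indep_vars (\<lambda>_. borel) \<epsilon> UNIV"
  shows "indep_var borel (\<lambda>x. garch_vol w a b s (\<lambda>j. \<epsilon> j x) k) borel (\<epsilon> k)"
proof -
  let ?V = "\<lambda>y. garch_vol w a b s y k"
  have "indep_var borel (?V \<circ> (\<lambda>x. restrict (\<lambda>i. \<epsilon> i x) {..<k}))
                  borel ((\<lambda>y. y k) \<circ> (\<lambda>x. restrict (\<lambda>i. \<epsilon> i x) {k}))"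
    using measurable_garch_vol[of k "\<lambda>j y. y j" "PiM {..<k} (\<lambda>_. borel)" w a b s]
    by (intro indep_var_compose[OF indep_var_restrict[OF assms]]) auto
  moreover have "?V \<circ> (\<lambda>x. restrict (\<lambda>i. \<epsilon> i x) {..<k}) = (\<lambda>x. garch_vol w a b s (\<lambda>j. \<epsilon> j x) k)"
    by (auto simp: fun_eq_iff intro!: garch_vol_cong)
  ultimately show ?thesis by (simp add: o_def)
qed

section \<open>Mean square deviation of the squared volatility from the fixed point
  \<open>m\<close>\<close>

context prob_space
begin

context
  fixes \<epsilon> :: "nat \<Rightarrow> 'a \<Rightarrow> real" and w a b s v m :: real
  assumes indep: "indep_vars (\<lambda>_. borel) \<epsilon> UNIV"
    and int4: "\<And>k. integrable M (\<lambda>x. (\<epsilon> k x)^4)"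
    and mean: "\<And>k. (\<integral>x. (\<epsilon> k x)\<^sup>2 \<partial>M) = 1"
    and var: "\<And>k. (\<integral>x. ((\<epsilon> k x)\<^sup>2 - 1)\<^sup>2 \<partial>M) = v"
    and nonneg: "w \<ge> 0" "a \<ge> 0" "b \<ge> 0"
    and stationary: "w + (a + b) * m = m"
begin

private abbreviation (input) vol where "vol k x \<equiv> garch_vol w a b s (\<lambda>j. \<epsilon> j x) k"

private lemma rv: "\<epsilon> k \<in> borel_measurable M"
  using indep by (auto simp: indep_vars_def)

private lemma rv_vol: "(\<lambda>x. vol k x) \<in> borel_measurable M"
  by (intro measurable_garch_vol rv)

private lemma int2: "integrable M (\<lambda>x. (\<epsilon> k x)\<^sup>2)"
proof (rule square_integrable_imp_integrable)
  show "integrable M (\<lambda>x. ((\<epsilon> k x)\<^sup>2)\<^sup>2)"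
    using int4[of k] by (simp flip: power_mult)
qed (use rv in simp)

private lemma indep_vol_innovation:
  assumes [measurable]: "f \<in> borel_measurable borel" "g \<in> borel_measurable borel"
    and "integrable M (\<lambda>x. f (vol k x) :: real)" "integrable M (\<lambda>x. g (\<epsilon> k x) :: real)"
  shows "integrable M (\<lambda>x. f (vol k x) * g (\<epsilon> k x))"
    and "(\<integral>x. f (vol k x) * g (\<epsilon> k x) \<partial>M) = (\<integral>x. f (vol k x) \<partial>M) * (\<integral>x. g (\<epsilon> k x) \<partial>M)"
proof -
  have "indep_var borel (f \<circ> (\<lambda>x. vol k x)) borel (g \<circ> \<epsilon> k)"
    using assms by (intro indep_var_compose[OF indep_var_garch_vol[OF indep]]) auto
  then have *: "indep_var borel (\<lambda>x. f (vol k x)) borel (\<lambda>x. g (\<epsilon> k x))"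
    by (simp add: o_def)
  show "integrable M (\<lambda>x. f (vol k x) * g (\<epsilon> k x))"
    using assms by (intro indep_var_integrable[OF *]) auto
  show "(\<integral>x. f (vol k x) * g (\<epsilon> k x) \<partial>M) = (\<integral>x. f (vol k x) \<partial>M) * (\<integral>x. g (\<epsilon> k x) \<partial>M)"
    using assms by (intro indep_var_lebesgue_integral[OF *]) auto
qed

private lemma int_vol2:
  assumes "integrable M (\<lambda>x. (vol k x)^4)"
  shows "integrable M (\<lambda>x. (vol k x)\<^sup>2)"
proof (rule square_integrable_imp_integrable)
  show "integrable M (\<lambda>x. ((vol k x)\<^sup>2)\<^sup>2)"
    using assms by (simp flip: power_mult)
qed (use rv_vol in simp)

text \<open>By induction: squaring the recursion for the squared volatility gives a sum of products
  of powers of \<open>vol k\<close> and \<open>\<epsilon> k\<close>, all of degree at most 4 in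
  each, and independence makes every product integrable.\<close>

private lemma int_vol4: "integrable M (\<lambda>x. (vol k x)^4)"
proof (induction k)
  case (Suc k)
  note V2 = int_vol2[OF Suc]
  have "(\<lambda>x. (vol (Suc k) x)^4) = (\<lambda>x. w\<^sup>2 + 2 * w * b * (vol k x)\<^sup>2 + b\<^sup>2 * (vol k x)^4 +
      2 * w * a * ((vol k x)\<^sup>2 * (\<epsilon> k x)\<^sup>2) + 2 * a * b * ((vol k x)^4 * (\<epsilon> k x)\<^sup>2) +
      a\<^sup>2 * ((vol k x)^4 * (\<epsilon> k x)^4))"
  proof
    fix x
    have "(vol (Suc k) x)^4 = ((vol (Suc k) x)\<^sup>2)\<^sup>2"
      by (simp only: power_mult[symmetric]) simp
    also have "\<dots> = (w + (a * (\<epsilon> k x)\<^sup>2 + b) * (vol k x)\<^sup>2)\<^sup>2"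
      by (simp only: garch_vol_Suc_sq[OF nonneg])
    also have "\<dots> = w\<^sup>2 + 2 * w * b * (vol k x)\<^sup>2 + b\<^sup>2 * (vol k x)^4 +
      2 * w * a * ((vol k x)\<^sup>2 * (\<epsilon> k x)\<^sup>2) + 2 * a * b * ((vol k x)^4 * (\<epsilon> k x)\<^sup>2) +
      a\<^sup>2 * ((vol k x)^4 * (\<epsilon> k x)^4)"
      by algebra
    finally show "(vol (Suc k) x)^4 = \<dots>" .
  qed
  moreover have "integrable M (\<lambda>x. (vol k x)\<^sup>2 * (\<epsilon> k x)\<^sup>2)"
    using indep_vol_innovation(1)[of "\<lambda>y. y\<^sup>2" "\<lambda>y. y\<^sup>2", OF _ _ V2 int2] by simp
  moreover have "integrable M (\<lambda>x. (vol k x)^4 * (\<epsilon> k x)\<^sup>2)"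
    using indep_vol_innovation(1)[of "\<lambda>y. y^4" "\<lambda>y. y\<^sup>2", OF _ _ Suc int2] by simp
  moreover have "integrable M (\<lambda>x. (vol k x)^4 * (\<epsilon> k x)^4)"
    using indep_vol_innovation(1)[of "\<lambda>y. y^4" "\<lambda>y. y^4", OF _ _ Suc int4] by simp
  ultimately show ?case
    using Suc V2 by (simp del: garch_vol.simps)
qed simp

private lemma dev_expand: "((vol k x)\<^sup>2 - m)\<^sup>2 = (vol k x)^4 - 2 * m * (vol k x)\<^sup>2 + m\<^sup>2"
  by algebra

lemma integrable_garch_vol_deviation: "integrable M (\<lambda>x. ((vol k x)\<^sup>2 - m)\<^sup>2)"
  unfolding dev_expand using int_vol4 int_vol2[OF int_vol4] by simp

text \<open>The new deviation is \<open>a + b\<close> times the old one plus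
  \<open>a * (\<epsilon>\<^sup>2 - 1) * vol\<^sup>2\<close>. In its square, independence kills the
  cross term, because \<open>\<epsilon>\<^sup>2 - 1\<close> has mean 0, and splits the noise term
  into \<open>v\<close> times a fourth moment.\<close>

lemma garch_vol_deviation_Suc:
  "(\<integral>x. ((vol (Suc k) x)\<^sup>2 - m)\<^sup>2 \<partial>M) =
     (a + b)\<^sup>2 * (\<integral>x. ((vol k x)\<^sup>2 - m)\<^sup>2 \<partial>M) + a\<^sup>2 * v * (\<integral>x. (vol k x)^4 \<partial>M)"
proof -
  note V4 = int_vol4[of k] and V2 = int_vol2[OF int_vol4[of k]]
  have c1: "integrable M (\<lambda>x. (\<epsilon> k x)\<^sup>2 - 1)" and c0: "(\<integral>x. (\<epsilon> k x)\<^sup>2 - 1 \<partial>M) = 0"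
    using int2 mean by (auto simp: prob_space)
  have "(\<lambda>x. ((\<epsilon> k x)\<^sup>2 - 1)\<^sup>2) = (\<lambda>x. (\<epsilon> k x)^4 - 2 * (\<epsilon> k x)\<^sup>2 + 1)"
    by (rule ext) algebra
  then have c2: "integrable M (\<lambda>x. ((\<epsilon> k x)\<^sup>2 - 1)\<^sup>2)"
    using int2 int4 by simp
  have "(\<lambda>x. ((vol k x)\<^sup>2 - m) * (vol k x)\<^sup>2) = (\<lambda>x. (vol k x)^4 - m * (vol k x)\<^sup>2)"
    by (rule ext) algebra
  then have V3: "integrable M (\<lambda>x. ((vol k x)\<^sup>2 - m) * (vol k x)\<^sup>2)"
    using V2 V4 by simp
  have cross: "integrable M (\<lambda>x. ((vol k x)\<^sup>2 - m) * (vol k x)\<^sup>2 * ((\<epsilon> k x)\<^sup>2 - 1))"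
    "(\<integral>x. ((vol k x)\<^sup>2 - m) * (vol k x)\<^sup>2 * ((\<epsilon> k x)\<^sup>2 - 1) \<partial>M) = 0"
    using indep_vol_innovation[of "\<lambda>y. (y\<^sup>2 - m) * y\<^sup>2" "\<lambda>y. y\<^sup>2 - 1", OF _ _ V3 c1] c0 by simp_all
  have noise: "integrable M (\<lambda>x. (vol k x)^4 * ((\<epsilon> k x)\<^sup>2 - 1)\<^sup>2)"
    "(\<integral>x. (vol k x)^4 * ((\<epsilon> k x)\<^sup>2 - 1)\<^sup>2 \<partial>M) = (\<integral>x. (vol k x)^4 \<partial>M) * v"
    using indep_vol_innovation[of "\<lambda>y. y^4" "\<lambda>y. (y\<^sup>2 - 1)\<^sup>2", OF _ _ V4 c2] var by simp_all
  have "(\<lambda>x. ((vol (Suc k) x)\<^sup>2 - m)\<^sup>2) = (\<lambda>x. (a + b)\<^sup>2 * ((vol k x)\<^sup>2 - m)\<^sup>2 +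
          2 * (a + b) * a * (((vol k x)\<^sup>2 - m) * (vol k x)\<^sup>2 * ((\<epsilon> k x)\<^sup>2 - 1)) +
          a\<^sup>2 * ((vol k x)^4 * ((\<epsilon> k x)\<^sup>2 - 1)\<^sup>2))"
  proof
    fix x
    have "(vol (Suc k) x)\<^sup>2 - m = (a + b) * ((vol k x)\<^sup>2 - m) + a * ((\<epsilon> k x)\<^sup>2 - 1) * (vol k x)\<^sup>2"
      unfolding garch_vol_Suc_sq[OF nonneg] using stationary by (simp add: algebra_simps)
    then have "((vol (Suc k) x)\<^sup>2 - m)\<^sup>2 =
        ((a + b) * ((vol k x)\<^sup>2 - m) + a * ((\<epsilon> k x)\<^sup>2 - 1) * (vol k x)\<^sup>2)\<^sup>2"
      by (simp only:)
    also have "\<dots> = (a + b)\<^sup>2 * ((vol k x)\<^sup>2 - m)\<^sup>2 +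
          2 * (a + b) * a * (((vol k x)\<^sup>2 - m) * (vol k x)\<^sup>2 * ((\<epsilon> k x)\<^sup>2 - 1)) +
          a\<^sup>2 * ((vol k x)^4 * ((\<epsilon> k x)\<^sup>2 - 1)\<^sup>2)"
      by algebra
    finally show "((vol (Suc k) x)\<^sup>2 - m)\<^sup>2 = \<dots>" .
  qed
  then show ?thesis
    using integrable_garch_vol_deviation[of k] cross noise
    by (simp del: garch_vol.simps)
qed

text \<open>Since \<open>vol^4 \<le> 2 * (vol\<^sup>2 - m)\<^sup>2 + 2 * m\<^sup>2\<close>, the
  fourth moment is controlled by the deviation itself, which closes the recursion as
  \<open>D (Suc k) \<le> r * D k + c\<close>. Its fixed point \<open>c / (1 - r)\<close> is the
  second summand; the initial deviation decays geometrically.\<close>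

lemma garch_vol_deviation_bound:
  assumes r: "(a + b)\<^sup>2 + 2 * a\<^sup>2 * v \<le> r" "r < 1"
  shows "(\<integral>x. ((vol k x)\<^sup>2 - m)\<^sup>2 \<partial>M) \<le> r ^ k * (s\<^sup>2 - m)\<^sup>2 + 2 * a\<^sup>2 * v * m\<^sup>2 / (1 - r)"
proof -
  have v: "v \<ge> 0"
    by (subst var[of 0, symmetric]) simp
  then have "0 \<le> (a + b)\<^sup>2 + 2 * a\<^sup>2 * v" by simp
  with r have r0: "r \<ge> 0" by linarith
  define c where "c = 2 * a\<^sup>2 * v * m\<^sup>2"
  have c: "c \<ge> 0" using v by (simp add: c_def)
  define D where "D k = (\<integral>x. ((vol k x)\<^sup>2 - m)\<^sup>2 \<partial>M)" for k
  have D: "D k \<ge> 0" for k unfolding D_def by simp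
  have rec: "D (Suc k) \<le> r * D k + c" for k
  proof -
    have "(\<integral>x. (vol k x)^4 \<partial>M) \<le> (\<integral>x. 2 * ((vol k x)\<^sup>2 - m)\<^sup>2 + 2 * m\<^sup>2 \<partial>M)"
    proof (intro integral_mono int_vol4)
      show "integrable M (\<lambda>x. 2 * ((vol k x)\<^sup>2 - m)\<^sup>2 + 2 * m\<^sup>2)"
        using integrable_garch_vol_deviation by simp
      fix x
      have "2 * ((vol k x)\<^sup>2 - m)\<^sup>2 + 2 * m\<^sup>2 - (vol k x)^4 = ((vol k x)\<^sup>2 - 2 * m)\<^sup>2"
        by algebra
      then show "(vol k x)^4 \<le> 2 * ((vol k x)\<^sup>2 - m)\<^sup>2 + 2 * m\<^sup>2"
        using zero_le_power2[of "(vol k x)\<^sup>2 - 2 * m"] by linarith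
    qed
    also have "\<dots> = 2 * D k + 2 * m\<^sup>2"
      using integrable_garch_vol_deviation by (simp add: D_def prob_space)
    finally have "a\<^sup>2 * v * (\<integral>x. (vol k x)^4 \<partial>M) \<le> a\<^sup>2 * v * (2 * D k + 2 * m\<^sup>2)"
      using v by (intro mult_left_mono) auto
    then have "D (Suc k) \<le> ((a + b)\<^sup>2 + 2 * a\<^sup>2 * v) * D k + c"
      unfolding D_def[of "Suc k"] garch_vol_deviation_Suc D_def[of k, symmetric]
      by (simp add: c_def algebra_simps)
    also have "\<dots> \<le> r * D k + c"
      using r D by (intro add_right_mono mult_right_mono) auto
    finally show ?thesis .
  qed
  have "D k \<le> r ^ k * (s\<^sup>2 - m)\<^sup>2 + c / (1 - r)"
  proof (induction k)
    case 0
    then show ?case using c r by (simp add: D_def prob_space)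
  next
    case (Suc k)
    have "D (Suc k) \<le> r * (r ^ k * (s\<^sup>2 - m)\<^sup>2 + c / (1 - r)) + c"
      using rec[of k] mult_left_mono[OF Suc r0] by linarith
    also have "\<dots> = r ^ Suc k * (s\<^sup>2 - m)\<^sup>2 + c / (1 - r)"
      using r by (simp add: field_simps)
    finally show ?case .
  qed
  then show ?thesis by (simp add: D_def c_def)
qed

end

end

section \<open>Concentration of the normalised volatility around 1\<close>

text \<open>Chebyshev's inequality for \<open>(vol\<^sup>2 - m) / m\<close> with
  \<open>m = w / g\<close>. After division by \<open>m\<^sup>2\<close> the influence of the starting
  value decays exponentially in \<open>k * g\<close>, and the accumulated noise is of order
  \<open>a\<^sup>2 / g\<close>.\<close>

lemma (in prob_space) garch_vol_concentration:
  fixes \<epsilon> :: "nat \<Rightarrow> 'a \<Rightarrow> real" and w a b s v d g :: real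
  assumes indep: "indep_vars (\<lambda>_. borel) \<epsilon> UNIV"
    and int4: "\<And>k. integrable M (\<lambda>x. (\<epsilon> k x)^4)"
    and mean: "\<And>k. (\<integral>x. (\<epsilon> k x)\<^sup>2 \<partial>M) = 1"
    and var: "\<And>k. (\<integral>x. ((\<epsilon> k x)\<^sup>2 - 1)\<^sup>2 \<partial>M) = v"
    and nonneg: "w > 0" "a \<ge> 0" "b \<ge> 0"
    and g: "g = 1 - a - b" "g > 0" and small: "4 * a\<^sup>2 * v \<le> g"
    and "k > 0" "d > 0"
  shows "prob {x\<in>space M. d < \<bar>sqrt (g / w) * garch_vol w a b s (\<lambda>j. \<epsilon> j x) k - 1\<bar>}
           \<le> (exp (- (real k * g) / 2) * (s\<^sup>2 * g / w - 1)\<^sup>2 + 4 * v * (a\<^sup>2 / g)) / d\<^sup>2"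
proof -
  let ?V = "\<lambda>x. garch_vol w a b s (\<lambda>j. \<epsilon> j x) k"
  have rv[measurable]: "\<epsilon> j \<in> borel_measurable M" for j
    using indep by (auto simp: indep_vars_def)
  have [measurable]: "?V \<in> borel_measurable M"
    by (rule measurable_garch_vol) simp
  define m where "m = w / g"
  have m: "m > 0" using nonneg g by (simp add: m_def)
  have fixpt: "w + (a + b) * m = m"
  proof -
    have "w = g * m" using g by (simp add: m_def)
    then show ?thesis by (simp add: g(1) algebra_simps)
  qed
  note moments = indep int4 mean var less_imp_le[OF nonneg(1)] nonneg(2,3) fixpt
  have "0 \<le> a + b" "a + b \<le> 1" using nonneg g by auto
  then have "(a + b)\<^sup>2 \<le> a + b"
    by (simp add: power2_eq_square mult_left_le)
  \<comment> \<open>Here \<open>a + b = 1 - g\<close>, and \<open>small\<close> lets the noise use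
    up at most half of the contraction \<open>g\<close>.\<close>
  then have "(a + b)\<^sup>2 + 2 * a\<^sup>2 * v \<le> 1 - g / 2"
    using small g by linarith
  then have "(\<integral>x. ((?V x)\<^sup>2 - m)\<^sup>2 \<partial>M) \<le> (1 - g / 2) ^ k * (s\<^sup>2 - m)\<^sup>2 + 2 * a\<^sup>2 * v * m\<^sup>2 / (1 - (1 - g / 2))"
    using g by (intro garch_vol_deviation_bound[OF moments]) auto
  also have "2 * a\<^sup>2 * v * m\<^sup>2 / (1 - (1 - g / 2)) = 4 * v * (a\<^sup>2 / g) * m\<^sup>2"
    using g(2) by simp
  also have "(1 - g / 2) ^ k * (s\<^sup>2 - m)\<^sup>2 + 4 * v * (a\<^sup>2 / g) * m\<^sup>2 \<le>
      exp (- (real k * g) / 2) * (s\<^sup>2 - m)\<^sup>2 + 4 * v * (a\<^sup>2 / g) * m\<^sup>2"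
  proof (intro add_right_mono mult_right_mono)
    have "(1 - g / 2) ^ k \<le> exp (- g / 2) ^ k"
      using exp_ge_add_one_self[of "- g / 2"] \<open>0 \<le> a + b\<close> g(1) by (intro power_mono) linarith+
    also have "\<dots> = exp (- (real k * g) / 2)"
      by (simp flip: exp_of_nat_mult)
    finally show "(1 - g / 2) ^ k \<le> exp (- (real k * g) / 2)" .
  qed simp
  finally have "(\<integral>x. ((?V x)\<^sup>2 - m)\<^sup>2 \<partial>M) \<le>
      exp (- (real k * g) / 2) * (s\<^sup>2 - m)\<^sup>2 + 4 * v * (a\<^sup>2 / g) * m\<^sup>2" .
  then have "(\<integral>x. ((?V x)\<^sup>2 - m)\<^sup>2 \<partial>M) / m\<^sup>2 \<le>
      (exp (- (real k * g) / 2) * (s\<^sup>2 - m)\<^sup>2 + 4 * v * (a\<^sup>2 / g) * m\<^sup>2) / m\<^sup>2"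
    by (rule divide_right_mono) simp
  also have "\<dots> = exp (- (real k * g) / 2) * ((s\<^sup>2 - m) / m)\<^sup>2 + 4 * v * (a\<^sup>2 / g)"
    using m by (simp add: power_divide add_divide_distrib)
  also have "(s\<^sup>2 - m) / m = s\<^sup>2 * g / w - 1"
    using nonneg g by (simp add: m_def field_simps)
  finally have bound: "(\<integral>x. (((?V x)\<^sup>2 - m) / m)\<^sup>2 \<partial>M) \<le>
      exp (- (real k * g) / 2) * (s\<^sup>2 * g / w - 1)\<^sup>2 + 4 * v * (a\<^sup>2 / g)"
    by (simp add: power_divide)
  have int: "integrable M (\<lambda>x. (((?V x)\<^sup>2 - m) / m)\<^sup>2)"
    using integrable_garch_vol_deviation[OF moments] by (simp add: power_divide)
  \<comment> \<open>For \<open>u \<ge> 0\<close> one has |u - 1| <= |u - 1| (u + 1) = |u^2 - 1|,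
    which passes from the squared volatility to the volatility. Nonnegativity rests on
    \<open>k > 0\<close>, as the initial value \<open>s\<close> may be negative.\<close>
  have "prob {x\<in>space M. d < \<bar>sqrt (g / w) * ?V x - 1\<bar>} \<le> prob {x\<in>space M. \<bar>((?V x)\<^sup>2 - m) / m\<bar> \<ge> d}"
  proof (intro finite_measure_mono subsetI)
    fix x assume x: "x \<in> {x\<in>space M. d < \<bar>sqrt (g / w) * ?V x - 1\<bar>}"
    define u where "u = sqrt (g / w) * ?V x"
    have u: "u \<ge> 0"
      unfolding u_def using nonneg g assms by (intro mult_nonneg_nonneg garch_vol_nonneg) auto
    have "u\<^sup>2 = (?V x)\<^sup>2 / m"
      using nonneg g by (simp add: u_def m_def power_mult_distrib)
    then have "((?V x)\<^sup>2 - m) / m = (u - 1) * (u + 1)"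
      using m by (simp add: diff_divide_distrib power2_eq_square algebra_simps)
    then have "\<bar>((?V x)\<^sup>2 - m) / m\<bar> = \<bar>u - 1\<bar> * (u + 1)"
      using u by (simp add: abs_mult)
    moreover have "\<bar>u - 1\<bar> * 1 \<le> \<bar>u - 1\<bar> * (u + 1)"
      using u by (intro mult_left_mono) auto
    ultimately show "x \<in> {x\<in>space M. \<bar>((?V x)\<^sup>2 - m) / m\<bar> \<ge> d}"
      using x by (auto simp: u_def)
  qed measurable
  also have "\<dots> \<le> (\<integral>x. (((?V x)\<^sup>2 - m) / m)\<^sup>2 \<partial>M) / d\<^sup>2"
    using assms by (intro second_moment_method int) auto
  also have "\<dots> \<le> (exp (- (real k * g) / 2) * (s\<^sup>2 * g / w - 1)\<^sup>2 + 4 * v * (a\<^sup>2 / g)) / d\<^sup>2"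
    by (intro divide_right_mono bound) simp
  finally show ?thesis .
qed

section \<open>Joint limit law of the observations at the sampled times\<close>

theorem theorem2p2:
  fixes M :: "'a measure"
    and \<epsilon> :: "nat \<Rightarrow> 'a \<Rightarrow> real"
    and \<omega> \<sigma>\<^sub>0 :: real
    and \<alpha> \<beta> \<gamma> :: "nat \<Rightarrow> real"
    and N :: nat
    and t :: "nat \<Rightarrow> real"
  assumes "prob_space M"
    and "prob_space.indep_vars M (\<lambda>_. borel) \<epsilon> UNIV"
    and "\<And>i. distr M borel (\<epsilon> i) = distr M borel (\<epsilon> 0)"
    and "\<not> (\<exists>c. AE x in M. (\<epsilon> 0 x)\<^sup>2 = c)"
    and "\<omega> > 0"
    and "\<And>n. n \<ge> 1 \<Longrightarrow> \<alpha> n \<ge> 0"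
    and "\<And>n. n \<ge> 1 \<Longrightarrow> \<beta> n \<ge> 0"
    and "\<alpha> \<longlonglongrightarrow> 0"
    and "\<beta> \<longlonglongrightarrow> 1"
    and "\<And>n. \<gamma> n = \<alpha> n + \<beta> n - 1"
    and "\<And>n. n \<ge> 1 \<Longrightarrow> \<gamma> n < 0"
    and "integrable M (\<lambda>x. (\<epsilon> 0 x)\<^sup>2)"
    and "(\<integral>x. (\<epsilon> 0 x)\<^sup>2 \<partial>M) = 1"
    and "\<exists>\<delta>>0. integrable M (\<lambda>x. \<bar>\<epsilon> 0 x\<bar> powr (4 + \<delta>))"
    and "filterlim (\<lambda>n. real n * \<alpha> n) at_top sequentially"
    and "(\<lambda>n. sqrt (real n) * \<gamma> n) \<longlonglongrightarrow> 0"
    and "filterlim (\<lambda>n. real n * \<bar>\<gamma> n\<bar>) at_top sequentially"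
    and "(\<lambda>n. \<alpha> n * sqrt (real n) * ln (ln (real n))) \<longlonglongrightarrow> 0"
    and "(\<lambda>n. \<bar>\<gamma> n\<bar> powr (3/2) / \<alpha> n) \<longlonglongrightarrow> 0"
    and "N \<ge> 1"
    and "\<And>m. m \<in> {1..N} \<Longrightarrow> 0 < t m \<and> t m \<le> 1"
    and "strict_mono_on {1..N} t"
  shows "weak_conv_on (product_topology (\<lambda>_. euclideanreal) {1..N})
           (\<lambda>n. distr M (\<Pi>\<^sub>M m\<in>{1..N}. borel)
              (\<lambda>x. \<lambda>m\<in>{1..N}. sqrt (\<bar>\<gamma> n\<bar> / \<omega>) *
                 garch \<omega> (\<alpha> n) (\<beta> n) \<sigma>\<^sub>0 (\<lambda>k. \<epsilon> k x) (nat \<lfloor>real n * t m\<rfloor>)))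
           (\<Pi>\<^sub>M m\<in>{1..N}. distr M borel (\<epsilon> 0))"
proof -
  interpret prob_space M by fact
  note indep = assms(2) and iid = assms(3)
  define g where "g n = \<bar>\<gamma> n\<bar>" for n
  define k where "k n m = nat \<lfloor>real n * t m\<rfloor>" for n m
  \<comment> \<open>The normalised observation is the product \<open>S n m * E n m\<close>: the
    \<open>S\<close> factor will tend to 1 in probability, and the \<open>E\<close> factor has the
    law of \<open>\<epsilon> 0\<close> for every \<open>n\<close>.\<close>
  define E where "E n m = \<epsilon> (k n m)" for n m
  define S where "S n m x = sqrt (g n / \<omega>) * garch_vol \<omega> (\<alpha> n) (\<beta> n) \<sigma>\<^sub>0 (\<lambda>k. \<epsilon> k x) (k n m)" for n m x
  define v where "v = (\<integral>x. ((\<epsilon> 0 x)\<^sup>2 - 1)\<^sup>2 \<partial>M)"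
  have rv[measurable]: "\<epsilon> j \<in> borel_measurable M" for j
    using indep by (auto simp: indep_vars_def)
  have [measurable]: "E n m \<in> borel_measurable M" for n m
    unfolding E_def by simp
  have [measurable]: "S n m \<in> borel_measurable M" for n m
    unfolding S_def using measurable_garch_vol[of "k n m" \<epsilon> M] by simp

  have int_id: "(\<integral>x. h (\<epsilon> j x) \<partial>M) = (\<integral>x. h (\<epsilon> 0 x) \<partial>M)"
    if [measurable]: "h \<in> borel_measurable borel" for h :: "real \<Rightarrow> real" and j
    using integral_distr[of "\<epsilon> j" M borel h] integral_distr[of "\<epsilon> 0" M borel h] iid[of j] by simp
  have integrable_id: "integrable M (\<lambda>x. h (\<epsilon> j x))"
    if [measurable]: "h \<in> borel_measurable borel" and "integrable M (\<lambda>x. h (\<epsilon> 0 x))"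
    for h :: "real \<Rightarrow> real" and j
    using integrable_distr_eq[of "\<epsilon> j" M borel h] integrable_distr_eq[of "\<epsilon> 0" M borel h]
      iid[of j] that by simp
  have int4_0: "integrable M (\<lambda>x. (\<epsilon> 0 x)^4)"
  proof -
    obtain \<delta> where \<delta>: "\<delta> > 0" "integrable M (\<lambda>x. \<bar>\<epsilon> 0 x\<bar> powr (4 + \<delta>))"
      using assms(14) by blast
    have "y^4 \<le> 1 + \<bar>y\<bar> powr (4 + \<delta>)" for y :: real
    proof (cases "\<bar>y\<bar> \<le> 1")
      case True
      then have "\<bar>y\<bar>^4 \<le> 1" by (intro power_le_one) auto
      then show ?thesis by (simp add: add_increasing2)
    next
      case False
      then have "\<bar>y\<bar> powr real 4 \<le> \<bar>y\<bar> powr (4 + \<delta>)"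
        using \<delta> by (intro powr_mono) auto
      then show ?thesis using False by (subst (asm) powr_realpow) auto
    qed
    moreover have "integrable M (\<lambda>x. 1 + \<bar>\<epsilon> 0 x\<bar> powr (4 + \<delta>))"
      using \<delta> by simp
    ultimately show ?thesis
      by (rule_tac Bochner_Integration.integrable_bound) (auto simp: add_nonneg_nonneg)
  qed
  have int4: "integrable M (\<lambda>x. (\<epsilon> j x)^4)" for j
    using integrable_id[of "\<lambda>y. y^4", OF _ int4_0] by simp
  have int2: "integrable M (\<lambda>x. (\<epsilon> j x)\<^sup>2)" for j
    using integrable_id[of "\<lambda>y. y\<^sup>2", OF _ assms(12)] by simp
  have mean: "(\<integral>x. (\<epsilon> j x)\<^sup>2 \<partial>M) = 1" for j
    using int_id[of "\<lambda>y. y\<^sup>2" j] assms(13) by simp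
  have var: "(\<integral>x. ((\<epsilon> j x)\<^sup>2 - 1)\<^sup>2 \<partial>M) = v" for j
    using int_id[of "\<lambda>y. (y\<^sup>2 - 1)\<^sup>2" j] by (simp add: v_def)

  have g_eq: "g n = 1 - \<alpha> n - \<beta> n" and g_pos: "g n > 0" if "n \<ge> 1" for n
    using assms(10)[of n] assms(11)[OF that] by (auto simp: g_def)
  have "(\<lambda>n. \<bar>\<alpha> n + \<beta> n - 1\<bar>) \<longlonglongrightarrow> \<bar>0 + 1 - 1\<bar>"
    by (intro tendsto_intros assms(8,9))
  then have g0: "g \<longlonglongrightarrow> 0"
    by (simp add: g_def[abs_def] assms(10))
  have ng: "filterlim (\<lambda>n. real n * g n) at_top sequentially"
    using assms(17) by (simp add: g_def)

  \<comment> \<open>The iterated logarithm is eventually at least 1, so the assumed rate dominates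
    this one.\<close>
  have "(\<lambda>n. \<alpha> n * sqrt (real n)) \<longlonglongrightarrow> 0"
  proof (rule tendsto_sandwich[OF _ _ tendsto_const assms(18)])
    show "\<forall>\<^sub>F n in sequentially. 0 \<le> \<alpha> n * sqrt (real n)"
      using assms(6) by (intro eventually_sequentiallyI[of 1]) auto
    have "filterlim (\<lambda>n. ln (ln (real n))) at_top sequentially"
      by (intro filterlim_compose[OF ln_at_top] filterlim_real_sequentially)
    then have "\<forall>\<^sub>F n in sequentially. 1 \<le> ln (ln (real n))"
      by (simp add: filterlim_at_top)
    then show "\<forall>\<^sub>F n in sequentially. \<alpha> n * sqrt (real n) \<le> \<alpha> n * sqrt (real n) * ln (ln (real n))"
      using eventually_ge_at_top[of 1]
    proof eventually_elim
      case (elim n)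
      then have "\<alpha> n * sqrt (real n) * 1 \<le> \<alpha> n * sqrt (real n) * ln (ln (real n))"
        using assms(6)[of n] by (intro mult_left_mono) auto
      then show ?case by simp
    qed
  qed
  then have "(\<lambda>n. (\<alpha> n * sqrt (real n))\<^sup>2 * inverse (real n * g n)) \<longlonglongrightarrow> 0\<^sup>2 * 0"
    by (intro tendsto_mult tendsto_power tendsto_inverse_0_at_top ng)
  moreover have "\<forall>\<^sub>F n in sequentially. (\<alpha> n * sqrt (real n))\<^sup>2 * inverse (real n * g n) = (\<alpha> n)\<^sup>2 / g n"
    by (intro eventually_sequentiallyI[of 1]) (simp add: power_mult_distrib divide_simps)
  ultimately have a2g: "(\<lambda>n. (\<alpha> n)\<^sup>2 / g n) \<longlonglongrightarrow> 0"
    by (simp add: tendsto_cong)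

  \<comment> \<open>The integer part costs at most 1 in \<open>k n m\<close>, hence at most
    \<open>g n\<close> in the product, and \<open>g n\<close> tends to 0.\<close>
  have kg: "filterlim (\<lambda>n. real (k n m) * g n) at_top sequentially" if "m \<in> {1..N}" for m
  proof (rule filterlim_at_top_mono)
    have t: "t m > 0" using assms(21)[OF that] by simp
    show "filterlim (\<lambda>n. - g n + t m * (real n * g n)) at_top sequentially"
      by (intro filterlim_tendsto_add_at_top[OF tendsto_minus[OF g0]]
          filterlim_tendsto_pos_mult_at_top[OF tendsto_const t ng])
    have "real (k n m) \<ge> real n * t m - 1" for n
      using t by (simp add: k_def)
    then have "(real n * t m - 1) * g n \<le> real (k n m) * g n" for n
      by (intro mult_right_mono) (auto simp: g_def)
    then show "\<forall>\<^sub>F n in sequentially. - g n + t m * (real n * g n) \<le> real (k n m) * g n"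
      by (simp add: algebra_simps)
  qed
  have k_pos: "\<forall>\<^sub>F n in sequentially. k n m > 0" if "m \<in> {1..N}" for m
  proof -
    have "\<forall>\<^sub>F n in sequentially. real (k n m) * g n > 0"
      using kg[OF that] by (simp add: filterlim_at_top_dense)
    then show ?thesis by eventually_elim (auto intro: gr0I)
  qed

  have conv: "(\<lambda>n. prob {x\<in>space M. d < \<bar>S n m x - 1\<bar>}) \<longlonglongrightarrow> 0" if m: "m \<in> {1..N}" and d: "d > 0" for m d
  proof (rule tendsto_sandwich[OF _ _ tendsto_const])
    let ?U = "\<lambda>n. (exp (- (real (k n m) * g n) / 2) * (\<sigma>\<^sub>0\<^sup>2 * g n / \<omega> - 1)\<^sup>2 + 4 * v * ((\<alpha> n)\<^sup>2 / g n)) / d\<^sup>2"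
    have "filterlim (\<lambda>n. - (real (k n m) * g n / 2)) at_bot sequentially"
    proof -
      have "filterlim (\<lambda>n. (1/2) * (real (k n m) * g n)) at_top sequentially"
        by (intro filterlim_tendsto_pos_mult_at_top[OF tendsto_const _ kg[OF m]]) auto
      then show ?thesis by (simp add: filterlim_uminus_at_top)
    qed
    then have "(\<lambda>n. exp (- (real (k n m) * g n / 2))) \<longlonglongrightarrow> 0"
      by (rule filterlim_compose[OF exp_at_bot])
    then have "?U \<longlonglongrightarrow> (0 * (\<sigma>\<^sub>0\<^sup>2 * 0 / \<omega> - 1)\<^sup>2 + 4 * v * 0) / d\<^sup>2"
      using assms(5) d by (intro tendsto_intros g0 a2g) auto
    then show "?U \<longlonglongrightarrow> 0" by simp
    \<comment> \<open>Eventually \<open>4 * v * ((\<alpha> n)\<^sup>2 / g n) < 1\<close>, which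
      supplies the smallness condition of the concentration lemma.\<close>
    have "(\<lambda>n. 4 * v * ((\<alpha> n)\<^sup>2 / g n)) \<longlonglongrightarrow> 4 * v * 0"
      by (intro tendsto_intros a2g)
    then have "\<forall>\<^sub>F n in sequentially. 4 * v * ((\<alpha> n)\<^sup>2 / g n) < 1"
      by (rule order_tendstoD) simp
    then show "\<forall>\<^sub>F n in sequentially. prob {x\<in>space M. d < \<bar>S n m x - 1\<bar>} \<le> ?U n"
      using k_pos[OF m] eventually_ge_at_top[of 1]
    proof eventually_elim
      case (elim n)
      have "4 * (\<alpha> n)\<^sup>2 * v \<le> g n"
        using elim g_pos[of n] by (simp add: field_simps)
      then show ?case
        unfolding S_def using elim g_pos[of n] g_eq[of n] assms(5-7) d
        by (intro garch_vol_concentration indep int4 mean var) auto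
    qed
  qed auto

  \<comment> \<open>Every \<open>E n m\<close> has second moment 1, so Chebyshev's inequality with
    \<open>R\<^sup>2 = 2 / e\<close> gives the bound \<open>e / 2\<close> uniformly in
    \<open>n\<close>.\<close>
  have tight: "\<exists>R. \<forall>n. prob {x\<in>space M. R < \<bar>E n m x\<bar>} < e" if "e > 0" for m and e :: real
  proof -
    define R where "R = sqrt (2 / e)"
    have R: "R > 0" "R\<^sup>2 = 2 / e" using that by (auto simp: R_def)
    have "prob {x\<in>space M. R < \<bar>E n m x\<bar>} < e" for n
    proof -
      have "prob {x\<in>space M. R < \<bar>E n m x\<bar>} \<le> prob {x\<in>space M. \<bar>E n m x\<bar> \<ge> R}"
        by (intro finite_measure_mono) auto
      also have "\<dots> \<le> (\<integral>x. (E n m x)\<^sup>2 \<partial>M) / R\<^sup>2"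
        using R int2 by (intro second_moment_method) (auto simp: E_def)
      also have "\<dots> = e / 2"
        using R mean by (simp add: E_def)
      finally show ?thesis using that by simp
    qed
    then show ?thesis by blast
  qed

  \<comment> \<open>Once \<open>n * (t j - t i)\<close> is at least 1 for every pair
    \<open>i < j\<close>, the integer parts are distinct; there are only finitely many
    pairs.\<close>
  have k_inj: "\<forall>\<^sub>F n in sequentially. inj_on (k n) {1..N}"
  proof -
    have "\<forall>\<^sub>F n in sequentially. k n i < k n j" if "i \<in> {1..N}" "j \<in> {1..N}" "i < j" for i j
    proof -
      have t: "0 < t i" "t i < t j"
        using that assms(21)[of i] assms(22) by (auto simp: strict_mono_on_def)
      have "filterlim (\<lambda>n. (t j - t i) * real n) at_top sequentially"
        using t by (intro filterlim_tendsto_pos_mult_at_top[OF tendsto_const _ filterlim_real_sequentially]) auto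
      then have "\<forall>\<^sub>F n in sequentially. 1 \<le> (t j - t i) * real n"
        by (simp add: filterlim_at_top)
      then show ?thesis
      proof eventually_elim
        case (elim n)
        have "0 \<le> real n * t i" using t by simp
        moreover have "real n * t i + 1 \<le> real n * t j" using elim by (simp add: algebra_simps)
        ultimately show ?case unfolding k_def by linarith
      qed
    qed
    then have "\<forall>\<^sub>F n in sequentially. \<forall>i\<in>{1..N}. \<forall>j\<in>{i<..N}. k n i < k n j"
      by (intro eventually_ball_finite ballI) auto
    then show ?thesis
    proof eventually_elim
      case (elim n)
      then show ?case
        by (intro strict_mono_on_imp_inj_on) (auto simp: strict_mono_on_def)
    qed
  qed
  \<comment> \<open>At distinct times the sampled innovations are independent copies of
    \<open>\<epsilon> 0\<close>, so their joint law equals the limit law exactly for all large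
    \<open>n\<close>.\<close>
  have law: "\<forall>\<^sub>F n in sequentially. distr M (\<Pi>\<^sub>M m\<in>{1..N}. borel) (\<lambda>x. \<lambda>m\<in>{1..N}. E n m x) =
               (\<Pi>\<^sub>M m\<in>{1..N}. distr M borel (\<epsilon> 0))"
    using k_inj
  proof eventually_elim
    case (elim n)
    \<comment> \<open>Injectivity makes the singleton blocks \<open>{k n m}\<close> disjoint;
      evaluating each block at its only index reindexes the independent family by
      \<open>m\<close>.\<close>
    have "indep_vars (\<lambda>m. PiM {k n m} (\<lambda>_. borel)) (\<lambda>m x. restrict (\<lambda>i. \<epsilon> i x) {k n m}) {1..N}"
      by (intro indep_vars_restrict[OF indep]) (auto simp: disjoint_family_on_def dest: inj_onD[OF elim])
    then have "indep_vars (\<lambda>_. borel) (\<lambda>m x. restrict (\<lambda>i. \<epsilon> i x) {k n m} (k n m)) {1..N}"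
      by (rule indep_vars_compose2[where Y="\<lambda>m y. y (k n m)" and N="\<lambda>_. borel"])
         (rule measurable_component_singleton, simp)
    also have "(\<lambda>m x. restrict (\<lambda>i. \<epsilon> i x) {k n m} (k n m)) = E n"
      by (simp add: E_def fun_eq_iff)
    finally have "distr M (\<Pi>\<^sub>M m\<in>{1..N}. borel) (\<lambda>x. \<lambda>m\<in>{1..N}. E n m x) =
        (\<Pi>\<^sub>M m\<in>{1..N}. distr M borel (E n m))"
      by (rule indep_vars_iff_distr_eq_PiM'[THEN iffD1, rotated 2])
         (use assms(20) in auto)
    also have "(\<lambda>m. distr M borel (E n m)) = (\<lambda>m. distr M borel (\<epsilon> 0))"
      unfolding E_def by (intro ext iid)
    finally show ?case .
  qed

  show ?thesis
    unfolding weak_conv_on_def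
  proof (intro allI impI, elim conjE)
    fix f :: "(nat \<Rightarrow> real) \<Rightarrow> real"
    assume f: "continuous_map (product_topology (\<lambda>_. euclideanreal) {1..N}) euclideanreal f"
      and bdd: "bounded (f ` topspace (product_topology (\<lambda>_. euclideanreal) {1..N}))"
    note [measurable] = borel_measurable_PiM_continuous_map[OF f]
    let ?P = "\<Pi>\<^sub>M m\<in>{1..N}. borel :: real measure"
    let ?Z = "\<lambda>n x. \<lambda>m\<in>{1..N}. sqrt (\<bar>\<gamma> n\<bar> / \<omega>) * garch \<omega> (\<alpha> n) (\<beta> n) \<sigma>\<^sub>0 (\<lambda>k. \<epsilon> k x) (nat \<lfloor>real n * t m\<rfloor>)"
    have Z: "?Z n = (\<lambda>x. \<lambda>m\<in>{1..N}. S n m x * E n m x)" for n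
      by (auto simp: S_def E_def g_def k_def garch_def fun_eq_iff)
    \<comment> \<open>Slutsky replaces the observations by the innovations inside the integral; by
      \<open>law\<close> the latter integrals are eventually constant, equal to the limit.\<close>
    have diff: "(\<lambda>n. (\<integral>x. f (\<lambda>m\<in>{1..N}. S n m x * E n m x) \<partial>M) - (\<integral>x. f (\<lambda>m\<in>{1..N}. E n m x) \<partial>M)) \<longlonglongrightarrow> 0"
      using tight conv by (intro slutsky_mult f bdd) auto
    have "\<forall>\<^sub>F n in sequentially. integral\<^sup>L (\<Pi>\<^sub>M m\<in>{1..N}. distr M borel (\<epsilon> 0)) f = (\<integral>x. f (\<lambda>m\<in>{1..N}. E n m x) \<partial>M)"
      using law
    proof eventually_elim
      case (elim n)
      show ?case
        unfolding elim[symmetric] by (rule integral_distr) measurable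
    qed
    then have "(\<lambda>n. \<integral>x. f (\<lambda>m\<in>{1..N}. E n m x) \<partial>M) \<longlonglongrightarrow> integral\<^sup>L (\<Pi>\<^sub>M m\<in>{1..N}. distr M borel (\<epsilon> 0)) f"
      by (rule Lim_transform_eventually[OF tendsto_const])
    from tendsto_add[OF diff this]
    have "(\<lambda>n. \<integral>x. f (\<lambda>m\<in>{1..N}. S n m x * E n m x) \<partial>M) \<longlonglongrightarrow> integral\<^sup>L (\<Pi>\<^sub>M m\<in>{1..N}. distr M borel (\<epsilon> 0)) f"
      by simp
    moreover have "integral\<^sup>L (distr M ?P (?Z n)) f = (\<integral>x. f (\<lambda>m\<in>{1..N}. S n m x * E n m x) \<partial>M)" for n
      unfolding Z by (rule integral_distr) measurable
    ultimately show "(\<lambda>n. integral\<^sup>L (distr M ?P (?Z n)) f) \<longlonglongrightarrow> integral\<^sup>L (\<Pi>\<^sub>M m\<in>{1..N}. distr M borel (\<epsilon> 0)) f"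
      by simp
  qed
qed

end
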